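(* Let $B=\{0,1\}^{\{0,1,2,\dots\}}$ with the product topology and Borel $\sigma$-algebra, let $R:B\to B$ be the one-sided shift $R(x_0,x_1,x_2,\dots)=(x_1,x_2,x_3,\dots)$, and let $F:B\times\{0,1\}\to B\times\{0,1\}$ be given by $F(x,y)=(R(x),x_0)$ for $x=(x_0,x_1,\dots)$. Let $\mu$ be an ergodic $R$-invariant probability measure on $B$. If there exists a $\mu$-measurable function $\phi:B\to\{0,1\}$ whose graph is an attractor of $F$ with basin of attraction $Z\times\{0,1\}$ for some set $Z\subset B$ with $\mu(Z)=1$, then the measure-theoretic entropy $h_\mu(R)$ is zero.
   Context: Let $\pi_2(x,y)=y$. The basin of attraction of the graph of $\phi:B\to\{0,1\}$ is the set of all $(x,y)\in B\times\{0,1\}$ for which there is $N$ such that $\pi_2(F^n(x,y))=\phi(R^n(x))$ for every $n\ge N$. That the graph of $\phi$ is an attractor with basin $Z\times\{0,1\}$ means that every point of $Z\times\{0,1\}$ is attracted in this sense (attractors are understood over $\mu$-almost every point of the base). *)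

theory Defs
  imports "HOL-Probability.Probability"
begin

section \<open>Invariant and ergodic measures\<close>

definition invariant_measure :: "'a measure \<Rightarrow> ('a \<Rightarrow> 'a) \<Rightarrow> bool" where
  "invariant_measure M T \<longleftrightarrow> T \<in> measurable M M \<and> distr M M T = M"

definition ergodic_measure :: "'a measure \<Rightarrow> ('a \<Rightarrow> 'a) \<Rightarrow> bool" where
  "ergodic_measure M T \<longleftrightarrow> invariant_measure M T \<and>
     (\<forall>A\<in>sets M. T -` A \<inter> space M = A \<longrightarrow> measure M A = 0 \<or> measure M A = 1)"

section \<open>Measure-theoretic (Kolmogorov--Sinai) entropy\<close>

definition finite_measurable_partition :: "'a measure \<Rightarrow> 'a set set \<Rightarrow> bool" where
  "finite_measurable_partition M P \<longleftrightarrow> finite P \<and> P \<subseteq> sets M \<and> partition_on (space M) P"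

text \<open>The convention that \<open>0 log 0 = 0\<close> is built in, the factor \<open>measure M A\<close> being zero.\<close>

definition partition_entropy :: "'a measure \<Rightarrow> 'a set set \<Rightarrow> real" where
  "partition_entropy M P = - (\<Sum>A\<in>P. measure M A * ln (measure M A))"

text \<open>Empty preimages are discarded, so that the preimage of a partition is again a partition
  in the sense of \<open>partition_on\<close>.\<close>

definition preimage_partition :: "'a measure \<Rightarrow> ('a \<Rightarrow> 'a) \<Rightarrow> 'a set set \<Rightarrow> 'a set set" where
  "preimage_partition M T P = (\<lambda>A. T -` A \<inter> space M) ` P - {{}}"

text \<open>The join of the preimages of \<open>P\<close> under \<open>T ^^ i\<close> for \<open>i < n\<close>; meaningful for \<open>n > 0\<close>.\<close>

definition iterated_join :: "'a measure \<Rightarrow> ('a \<Rightarrow> 'a) \<Rightarrow> 'a set set \<Rightarrow> nat \<Rightarrow> 'a set set" where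
  "iterated_join M T P n = common_refinement ((\<lambda>i. preimage_partition M (T ^^ i) P) ` {..<n})"

text \<open>For an invariant probability measure the limit below exists by subadditivity.\<close>

definition entropy_wrt_partition :: "'a measure \<Rightarrow> ('a \<Rightarrow> 'a) \<Rightarrow> 'a set set \<Rightarrow> real" where
  "entropy_wrt_partition M T P = lim (\<lambda>n. partition_entropy M (iterated_join M T P n) / real n)"

definition measure_entropy :: "'a measure \<Rightarrow> ('a \<Rightarrow> 'a) \<Rightarrow> ereal" where
  "measure_entropy M T =
     (SUP P\<in>{P. finite_measurable_partition M P}. ereal (entropy_wrt_partition M T P))"

section \<open>The skew product over the one-sided shift\<close>

text \<open>The symbols 0 and 1 are represented by \<open>False\<close> and \<open>True\<close>. The type \<open>bool\<close> carries the
  discrete topology and \<open>nat \<Rightarrow> bool\<close> the product topology.\<close>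

type_synonym symbol_seq = "nat \<Rightarrow> bool"

definition left_shift :: "symbol_seq \<Rightarrow> symbol_seq" where
  "left_shift x = (\<lambda>n. x (Suc n))"

definition skew_map :: "symbol_seq \<times> bool \<Rightarrow> symbol_seq \<times> bool" where
  "skew_map = (\<lambda>(x, y). (left_shift x, x 0))"

definition basin_of_graph :: "(symbol_seq \<Rightarrow> bool) \<Rightarrow> (symbol_seq \<times> bool) set" where
  "basin_of_graph \<phi> =
     {p. \<exists>N. \<forall>n\<ge>N. snd ((skew_map ^^ n) p) = \<phi> ((left_shift ^^ n) (fst p))}"

text \<open>Attraction is required of every point over \<open>Z\<close>; points outside \<open>Z \<times> {0,1}\<close>
  are not excluded from being attracted.\<close>

definition graph_attracts_over :: "(symbol_seq \<Rightarrow> bool) \<Rightarrow> symbol_seq set \<Rightarrow> bool" where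
  "graph_attracts_over \<phi> Z \<longleftrightarrow> Z \<times> UNIV \<subseteq> basin_of_graph \<phi>"

end

theory Submission
  imports Defs
begin

text \<open>
  Since \<open>F\<^sup>n (x, y) = (R\<^sup>n x, x\<^sub>n\<^sub>-\<^sub>1)\<close>, attraction says that almost surely
  \<open>x\<^sub>n = \<phi> (R\<^sup>n\<^sup>+\<^sup>1 x)\<close> for all large \<open>n\<close>; as the measure of the exceptional event does not
  depend on \<open>n\<close>, in fact \<open>x\<^sub>0 = \<phi> (R x)\<close> almost surely. Hence \<open>x\<^sub>0\<close> is, up to a correction
  variable of small entropy, a function of \<open>x\<^sub>1, \<dots>, x\<^sub>m\<close>, and likewise the label of \<open>x\<close> in any finite
  partition is, up to such a correction, a function of finitely many symbols. The labels of
  \<open>x, \<dots>, R\<^sup>n\<^sup>-\<^sup>1 x\<close> can therefore be decoded backwards from \<open>x\<^sub>n, \<dots>, x\<^sub>n\<^sub>+\<^sub>m\<^sub>-\<^sub>1\<close> and \<open>n\<close> pairs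
  of corrections, so that their joint entropy is at most a constant plus \<open>n \<epsilon>\<close>.
\<close>

section \<open>Entropy of simple functions\<close>

context information_space
begin

lemma entropy_simple_function:
  assumes "simple_function M X"
  shows "\<H>(X) = - (\<Sum>v\<in>X ` space M. prob (X -` {v} \<inter> space M) * log b (prob (X -` {v} \<inter> space M)))"
  by (rule entropy_simple_distributed[OF simple_distributedI[OF assms measure_nonneg refl]])

text \<open>On \<open>space M\<close>, \<open>Y\<close> factors through \<open>X\<close> by way of a
  representative picked with \<open>SOME\<close>, so data processing applies. Later decoding
  arguments then need no explicit decoder: it suffices that equal codes force equal outputs.\<close>

lemma simple_function_of_determined:
  assumes X: "simple_function M X"
    and det: "\<And>x y. x \<in> space M \<Longrightarrow> y \<in> space M \<Longrightarrow> X x = X y \<Longrightarrow> Y x = Y y"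
  shows "simple_function M Y" and "\<H>(Y) \<le> \<H>(X)"
proof -
  define f where "f v = Y (SOME x. x \<in> space M \<and> X x = v)" for v
  have f: "f (X x) = Y x" if "x \<in> space M" for x
  proof -
    have "\<exists>z. z \<in> space M \<and> X z = X x" using that by blast
    then have "(SOME z. z \<in> space M \<and> X z = X x) \<in> space M \<and> X (SOME z. z \<in> space M \<and> X z = X x) = X x"
      by (rule someI_ex)
    then show ?thesis unfolding f_def using det that by blast
  qed
  have fX: "simple_function M (f \<circ> X)" by (rule simple_function_compose[OF X])
  show Y: "simple_function M Y"
    using fX simple_function_cong[of M "f \<circ> X" Y] f by simp
  have im: "(f \<circ> X) ` space M = Y ` space M" using f by force
  have pre: "(f \<circ> X) -` {v} \<inter> space M = Y -` {v} \<inter> space M" for v using f by auto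
  have "\<H>(Y) = \<H>(f \<circ> X)"
    using entropy_simple_function[OF Y] entropy_simple_function[OF fX] unfolding im pre by simp
  then show "\<H>(Y) \<le> \<H>(X)" using entropy_data_processing[OF X, of f] by simp
qed

lemma entropy_nonneg:
  assumes "simple_function M X"
  shows "0 \<le> \<H>(X)"
proof -
  have "prob A * log b (prob A) \<le> 0" for A
  proof (cases "prob A = 0")
    case False
    then have "log b (prob A) \<le> 0" using b_gt_1 by (simp add: zero_less_measure_iff log_le_zero_cancel_iff)
    then show ?thesis by (simp add: mult_nonneg_nonpos)
  qed simp
  then show ?thesis unfolding entropy_simple_function[OF assms] by (simp add: sum_nonpos)
qed

lemma entropy_Pair_le:
  assumes X: "simple_function M X" and Y: "simple_function M Y"
  shows "\<H>(\<lambda>x. (X x, Y x)) \<le> \<H>(X) + \<H>(Y)"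
  using entropy_chain_rule[OF X Y] conditional_entropy_less_eq_entropy[OF Y X] by simp

text \<open>Induction on the length: the longer list is determined by the shorter one together with
  the last variable. Lists give blocks of all lengths a single type.\<close>

lemma entropy_map_upt_le:
  assumes X: "\<And>i. simple_function M (X i)"
  shows "simple_function M (\<lambda>x. map (\<lambda>i. X i x) [0..<n])"
    and "\<H>(\<lambda>x. map (\<lambda>i. X i x) [0..<n]) \<le> (\<Sum>i<n. \<H>(X i))"
proof (induction n)
  case 0
  { case 1 show ?case by simp }
  { case 2 show ?case by (subst entropy_simple_function) (auto simp: image_constant_conv prob_space) }
next
  case (Suc n)
  let ?L = "\<lambda>x. map (\<lambda>i. X i x) [0..<n]"
  have P: "simple_function M (\<lambda>x. (?L x, X n x))" using Suc(1) X by (rule simple_function_Pair)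
  note S = simple_function_of_determined[OF P, of "\<lambda>x. map (\<lambda>i. X i x) [0..<Suc n]"]
  { case 1 show ?case by (rule S(1)) auto }
  { case 2
    have "\<H>(\<lambda>x. map (\<lambda>i. X i x) [0..<Suc n]) \<le> \<H>(\<lambda>x. (?L x, X n x))"
      by (rule S(2)) auto
    then show ?case using Suc(2) entropy_Pair_le[OF Suc(1) X, of n] by simp }
qed

text \<open>The fibres of the composite are the \<open>S\<close>-preimages of the fibres of
  \<open>X\<close>, so they have the same probabilities.\<close>

lemma entropy_comp_invariant:
  assumes X: "simple_function M X" and S: "S \<in> measurable M M" "distr M M S = M"
  shows "simple_function M (\<lambda>x. X (S x))" and "\<H>(\<lambda>x. X (S x)) = \<H>(X)"
proof -
  have sp: "S x \<in> space M" if "x \<in> space M" for x using S(1) that by (rule measurable_space)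
  have pre: "(\<lambda>x. X (S x)) -` {v} \<inter> space M = S -` (X -` {v} \<inter> space M) \<inter> space M" for v
    using sp by auto
  have mX: "X -` {v} \<inter> space M \<in> sets M" for v using X by (rule simple_functionD)
  have sub: "(\<lambda>x. X (S x)) ` space M \<subseteq> X ` space M" using sp by auto
  show XS: "simple_function M (\<lambda>x. X (S x))"
    unfolding simple_function_def
    using finite_subset[OF sub] simple_functionD(1)[OF X] pre measurable_sets[OF S(1) mX] by auto
  have pr: "prob ((\<lambda>x. X (S x)) -` {v} \<inter> space M) = prob (X -` {v} \<inter> space M)" for v
    unfolding pre using measure_distr[OF S(1) mX] S(2) by simp
  \<comment> \<open>Values of \<open>X\<close> missed by the composite have null fibres, so summing
    over the smaller range loses nothing.\<close>
  have "prob (X -` {v} \<inter> space M) = 0" if "v \<notin> (\<lambda>x. X (S x)) ` space M" for v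
  proof -
    have "(\<lambda>x. X (S x)) -` {v} \<inter> space M = {}" using that by auto
    then show ?thesis using pr[of v] by simp
  qed
  then show "\<H>(\<lambda>x. X (S x)) = \<H>(X)"
    unfolding entropy_simple_function[OF X] entropy_simple_function[OF XS] pr
    by (simp add: sum.mono_neutral_left[OF simple_functionD(1)[OF X] sub])
qed

text \<open>The variable \<open>e\<close> is the correction needed to recover \<open>f\<close> from \<open>g\<close>.\<close>

lemma entropy_mismatch_le:
  assumes f: "simple_function M f" and g: "simple_function M g"
  defines "e \<equiv> \<lambda>x. if f x = g x then None else Some (f x)"
  shows "simple_function M e"
    and "\<H>(e) \<le> (card (f ` space M) + 1) * (2 * sqrt (prob {x \<in> space M. f x \<noteq> g x})) / ln b"
proof -
  show e: "simple_function M e"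
    by (rule simple_function_of_determined[OF simple_function_Pair[OF f g]]) (auto simp: e_def)
  let ?d = "prob {x \<in> space M. f x \<noteq> g x}"
  have lnb: "ln b > 0" using b_gt_1 by simp
  have ev: "{x \<in> space M. f x \<noteq> g x} \<in> events"
  proof -
    have "{x \<in> space M. f x \<noteq> g x} = space M - (e -` {None} \<inter> space M)" by (auto simp: e_def)
    then show ?thesis using simple_functionD(2)[OF e] by (metis sets.compl_sets)
  qed
  have d1: "?d \<le> sqrt ?d"
    by (simp add: real_le_rsqrt power2_eq_square mult_left_le)
  \<comment> \<open>One bound serves both kinds of value: the fibre of \<open>None\<close> has mass
    \<open>1 - ?d\<close>, and a fibre over some \<open>Some u\<close> has mass at most
    \<open>?d\<close>.\<close>
  have bound: "- (prob (e -` {v} \<inter> space M) * ln (prob (e -` {v} \<inter> space M))) \<le> 2 * sqrt ?d" for v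
  proof -
    let ?t = "prob (e -` {v} \<inter> space M)"
    consider "?t = 0" | "?t > 0" "v = None" | "?t > 0" "v \<noteq> None" using zero_less_measure_iff by blast
    then show ?thesis
    proof cases
      case 1 then show ?thesis by simp
    next
      case 2
      have "- ln ?t \<le> 1 / ?t - 1" using ln_le_minus_one[of "1 / ?t"] 2 by (simp add: ln_div)
      then have "?t * - ln ?t \<le> ?t * (1 / ?t - 1)" by (rule mult_left_mono) simp
      also have "\<dots> = 1 - ?t" using 2 by (simp add: field_simps)
      also have "\<dots> = ?d"
      proof -
        have "space M - (e -` {v} \<inter> space M) = {x \<in> space M. f x \<noteq> g x}" using 2 by (auto simp: e_def)
        then show ?thesis using prob_compl[OF simple_functionD(2)[OF e], of "{v}"] by simp
      qed
      finally have "- (?t * ln ?t) \<le> ?d" by simp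
      moreover have "0 \<le> sqrt ?d" by simp
      ultimately show ?thesis using d1 by linarith
    next
      \<comment> \<open>Here \<open>- t ln t = - 2 s\<^sup>2 ln s \<le> 2 (s - s\<^sup>2)\<close> with \<open>s = sqrt t\<close>.\<close>
      case 3
      let ?s = "sqrt ?t"
      have s: "?s > 0" "?t = ?s * ?s" using 3 by auto
      have "- ln ?s \<le> 1 / ?s - 1" using ln_le_minus_one[of "1 / ?s"] s by (simp add: ln_div)
      then have "?t * - ln ?s \<le> ?t * (1 / ?s - 1)" by (rule mult_left_mono) simp
      also have "\<dots> = ?s - ?t" using s by (simp add: field_simps)
      also have "\<dots> \<le> ?s" by simp
      finally have "- (?t * ln ?t) \<le> 2 * ?s" using 3 by (simp add: ln_sqrt)
      moreover have "?t \<le> ?d" by (rule finite_measure_mono[OF _ ev]) (use 3 in \<open>auto simp: e_def split: if_splits\<close>)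
      ultimately show ?thesis by (meson mult_left_mono order_trans real_sqrt_le_mono zero_le_numeral)
    qed
  qed
  have "e ` space M \<subseteq> insert None (Some ` f ` space M)" by (auto simp: e_def)
  then have "card (e ` space M) \<le> card (insert None (Some ` f ` space M))"
    using simple_functionD(1)[OF f] by (intro card_mono) auto
  also have "\<dots> \<le> card (f ` space M) + 1"
    by (metis Suc_eq_plus1 card_image inj_Some card_insert_le_m1 card_insert_if finite_insert card.infinite le_SucI order_refl le0)
  finally have card: "card (e ` space M) \<le> card (f ` space M) + 1" .
  have "\<H>(e) * ln b = (\<Sum>v\<in>e ` space M. - (prob (e -` {v} \<inter> space M) * ln (prob (e -` {v} \<inter> space M))))"
    unfolding entropy_simple_function[OF e] using lnb
    by (simp add: log_def sum_negf sum_distrib_right)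
  also have "\<dots> \<le> card (e ` space M) * (2 * sqrt ?d)"
    using sum_bounded_above[of "e ` space M" "\<lambda>v. - (prob (e -` {v} \<inter> space M) * ln (prob (e -` {v} \<inter> space M)))", OF bound] by simp
  also have "\<dots> \<le> (card (f ` space M) + 1) * (2 * sqrt ?d)"
    using card by (intro mult_right_mono) auto
  finally show "\<H>(e) \<le> (card (f ` space M) + 1) * (2 * sqrt ?d) / ln b"
    using lnb by (simp add: pos_le_divide_eq)
qed

text \<open>The bound of \<open>entropy_mismatch_le\<close> depends on \<open>g\<close> only through
  the mismatch probability, so the threshold can be fixed before the approximant \<open>g\<close> is
  chosen.\<close>

lemma entropy_mismatch_small:
  assumes f: "simple_function M f" and "0 < \<epsilon>"
  shows "\<exists>d>0. \<forall>g. simple_function M g \<longrightarrow> prob {x \<in> space M. f x \<noteq> g x} < d \<longrightarrow>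
    \<H>(\<lambda>x. if f x = g x then None else Some (f x)) \<le> \<epsilon>"
proof -
  define c where "c = real (card (f ` space M) + 1)"
  have "c > 0" by (simp add: c_def)
  have lnb: "ln b > 0" using b_gt_1 by simp
  \<comment> \<open>\<open>s\<close> solves \<open>c * (2 * s) / ln b = \<epsilon>\<close>. The
    bound contains the square root of the probability, so the threshold for the probability is
    \<open>s\<^sup>2\<close>.\<close>
  define s where "s = \<epsilon> * ln b / (2 * c)"
  have "s > 0" using lnb \<open>0 < \<epsilon>\<close> \<open>c > 0\<close> by (simp add: s_def)
  have "\<H>(\<lambda>x. if f x = g x then None else Some (f x)) \<le> \<epsilon>"
    if g: "simple_function M g" and d: "prob {x \<in> space M. f x \<noteq> g x} < s\<^sup>2" for g
  proof -
    have "sqrt (prob {x \<in> space M. f x \<noteq> g x}) \<le> s"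
      using d \<open>s > 0\<close> by (intro real_le_lsqrt) auto
    then have "c * (2 * sqrt (prob {x \<in> space M. f x \<noteq> g x})) / ln b \<le> c * (2 * s) / ln b"
      using lnb \<open>c > 0\<close> by (intro divide_right_mono mult_left_mono) auto
    also have "\<dots> = \<epsilon>" using lnb \<open>c > 0\<close> by (simp add: s_def)
    finally show ?thesis using entropy_mismatch_le(2)[OF f g] by (simp add: c_def)
  qed
  then show ?thesis using \<open>s > 0\<close> by (intro exI[of _ "s\<^sup>2"]) auto
qed

text \<open>Fibres over values in the range are nonempty and disjoint, hence distinct, and the sum
  can be reindexed by values. The factor \<open>ln b\<close> passes from base \<open>b\<close> to
  the natural logarithm of \<open>partition_entropy\<close>.\<close>

lemma partition_entropy_fibres:
  assumes X: "simple_function M X"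
  shows "partition_entropy M ((\<lambda>v. X -` {v} \<inter> space M) ` X ` space M) = \<H>(X) * ln b"
proof -
  have "inj_on (\<lambda>v. X -` {v} \<inter> space M) (X ` space M)" by (rule inj_onI) blast
  moreover have "ln b \<noteq> 0" using b_gt_1 by simp
  ultimately show ?thesis
    unfolding partition_entropy_def entropy_simple_function[OF X]
    by (simp add: sum.reindex log_def sum_distrib_right)
qed

end

section \<open>Invariant measures and iterated joins\<close>

lemma invariant_measure_funpow:
  assumes "invariant_measure M T"
  shows "(T ^^ n) \<in> measurable M M" and "distr M M (T ^^ n) = M"
proof (induction n)
  case 0
  { case 1 show ?case by (simp add: id_def) }
  { case 2 show ?case by (simp add: id_def distr_id2) }
next
  case (Suc n)
  have T: "T \<in> measurable M M" "distr M M T = M" using assms by (auto simp: invariant_measure_def)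
  { case 1 show ?case using Suc(1) T(1) by (simp add: measurable_comp) }
  { case 2 show ?case using distr_distr[OF T(1) Suc(1)] Suc(2) T(2) by (simp add: comp_def) }
qed

text \<open>The set \<open>B N\<close> of points that visit \<open>E\<close> at some time from
  \<open>N\<close> on has at least the mass of \<open>E\<close>, by invariance. These sets decrease
  to the set of points visiting \<open>E\<close> infinitely often, which is null by
  assumption.\<close>

lemma (in prob_space) eventually_avoided_imp_null:
  assumes T: "invariant_measure M T" and E: "E \<in> events"
    and ae: "AE x in M. \<exists>N. \<forall>n\<ge>N. (T ^^ n) x \<notin> E"
  shows "prob E = 0"
proof -
  define B where "B N = (\<Union>n\<in>{N..}. (T ^^ n) -` E \<inter> space M)" for N :: nat
  have pre: "(T ^^ n) -` E \<inter> space M \<in> events" for n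
    using measurable_sets[OF invariant_measure_funpow(1)[OF T] E] .
  have B: "range B \<subseteq> events" unfolding B_def using pre by (intro image_subsetI sets.countable_UN') auto
  have "decseq B" unfolding B_def decseq_def by force
  from finite_Lim_measure_decseq[OF B this]
  have lim: "(\<lambda>n. prob (B n)) \<longlonglongrightarrow> prob (\<Inter>n. B n)" .
  have "AE x in M. x \<notin> (\<Inter>n. B n)" using ae by (rule eventually_mono) (force simp: B_def)
  then have "prob (\<Inter>n. B n) = 0"
    using B by (subst prob_eq_0) auto
  moreover have "prob E \<le> prob (B n)" for n
  proof -
    have "prob E = prob ((T ^^ n) -` E \<inter> space M)"
      using measure_distr[OF invariant_measure_funpow(1)[OF T] E] invariant_measure_funpow(2)[OF T] by metis
    also have "\<dots> \<le> prob (B n)" using B by (intro finite_measure_mono) (auto simp: B_def)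
    finally show ?thesis .
  qed
  ultimately have "prob E \<le> 0"
    using LIMSEQ_le_const[OF lim, of "prob E"] by auto
  then show ?thesis by (simp add: measure_le_0_iff)
qed

text \<open>Codes a partition as a random variable, so that the entropy theory of simple functions
  applies to it. The value is unspecified outside the partitioned set.\<close>

definition partition_label :: "'a set set \<Rightarrow> 'a \<Rightarrow> 'a set" where
  "partition_label P x = (THE A. A \<in> P \<and> x \<in> A)"

lemma partition_label:
  assumes "partition_on S P" and "x \<in> S"
  shows "partition_label P x \<in> P" and "x \<in> partition_label P x"
    and "\<And>A. A \<in> P \<Longrightarrow> x \<in> A \<Longrightarrow> partition_label P x = A"
proof -
  have ex1: "\<exists>!A. A \<in> P \<and> x \<in> A"
  proof (rule ex_ex1I)
    show "\<exists>A. A \<in> P \<and> x \<in> A" using assms partition_onD1 by blast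
    show "A = B" if "A \<in> P \<and> x \<in> A" "B \<in> P \<and> x \<in> B" for A B
      using that disjointD[OF partition_onD2[OF assms(1)], of A B] by blast
  qed
  from theI'[OF ex1] show "partition_label P x \<in> P" "x \<in> partition_label P x"
    unfolding partition_label_def by blast+
  show "partition_label P x = A" if "A \<in> P" "x \<in> A" for A
    unfolding partition_label_def using that by (intro the1_equality[OF ex1]) simp
qed

lemma simple_function_partition_label:
  assumes "finite_measurable_partition M P"
  shows "simple_function M (partition_label P)"
proof -
  have P: "finite P" "P \<subseteq> sets M" "partition_on (space M) P"
    using assms by (auto simp: finite_measurable_partition_def)
  have im: "partition_label P ` space M \<subseteq> P" using partition_label(1)[OF P(3)] by auto
  have "partition_label P -` {A} \<inter> space M = A" if A: "A \<in> P" for A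
  proof (rule set_eqI)
    fix x
    have "x \<in> A \<Longrightarrow> x \<in> space M" using A P(2) sets.sets_into_space by blast
    then show "x \<in> partition_label P -` {A} \<inter> space M \<longleftrightarrow> x \<in> A"
      using partition_label(2)[OF P(3), of x] partition_label(3)[OF P(3) _ A, of x] by auto
  qed
  then have meas: "partition_label P -` {A} \<inter> space M \<in> sets M" if "A \<in> P" for A
    using that P(2) by auto
  show ?thesis
    unfolding simple_function_def
  proof (intro conjI ballI)
    show "finite (partition_label P ` space M)" by (rule finite_subset[OF im P(1)])
    show "partition_label P -` {A} \<inter> space M \<in> sets M" if "A \<in> partition_label P ` space M" for A
      using meas im that by auto
  qed
qed

text \<open>Two points share a cell of the join exactly when their label itineraries of length
  \<open>n\<close> coincide. This turns the entropy of the join into the entropy of one list-valued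
  variable.\<close>

lemma iterated_join_eq_fibres:
  assumes P: "partition_on (space M) P" and T: "\<And>i x. x \<in> space M \<Longrightarrow> (T ^^ i) x \<in> space M"
  defines "X \<equiv> \<lambda>n x. map (\<lambda>i. partition_label P ((T ^^ i) x)) [0..<n]"
  assumes n: "0 < n"
  shows "iterated_join M T P n = (\<lambda>v. X n -` {v} \<inter> space M) ` X n ` space M"
proof -
  let ?Q = "\<lambda>i. preimage_partition M (T ^^ i) P"
  have cell: "y \<in> D \<longleftrightarrow> y \<in> space M \<and> partition_label P ((T ^^ i) y) = partition_label P ((T ^^ i) x)"
    if "x \<in> D" "D \<in> ?Q i" for x y i D
  proof -
    obtain A where A: "A \<in> P" "D = (T ^^ i) -` A \<inter> space M"
      using \<open>D \<in> ?Q i\<close> by (auto simp: preimage_partition_def)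
    have label: "z \<in> D \<longleftrightarrow> z \<in> space M \<and> partition_label P ((T ^^ i) z) = A" for z
    proof (cases "z \<in> space M")
      case True
      show ?thesis using partition_label(2)[OF P T[OF True, of i]] partition_label(3)[OF P T[OF True, of i] A(1)] True A(2)
        by auto
    qed (simp add: A(2))
    then show ?thesis using \<open>x \<in> D\<close> by simp
  qed
  have X_eq: "X n y = X n x \<longleftrightarrow> (\<forall>i<n. partition_label P ((T ^^ i) y) = partition_label P ((T ^^ i) x))" for x y
    by (auto simp: X_def)
  show ?thesis
  proof (rule set_eqI)
    fix D
    show "D \<in> iterated_join M T P n \<longleftrightarrow> D \<in> (\<lambda>v. X n -` {v} \<inter> space M) ` X n ` space M"
    proof
      assume "D \<in> iterated_join M T P n"
      then obtain f where f_Pi: "f \<in> (\<Pi> R\<in>?Q ` {..<n}. R)"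
        and D: "D = \<Inter> (f ` ?Q ` {..<n})" and "D \<noteq> {}"
        unfolding iterated_join_def common_refinement by auto
      then obtain x where x: "x \<in> D" by blast
      have f: "f (?Q i) \<in> ?Q i" if "i < n" for i
        using Pi_mem[OF f_Pi] that by blast
      have xf: "x \<in> f (?Q i)" if "i < n" for i using x D that by blast
      have "y \<in> D \<longleftrightarrow> y \<in> space M \<and> X n y = X n x" for y
      proof -
        have "y \<in> D \<longleftrightarrow> (\<forall>i<n. y \<in> f (?Q i))" unfolding D by blast
        also have "\<dots> \<longleftrightarrow> (\<forall>i<n. y \<in> space M \<and> partition_label P ((T ^^ i) y) = partition_label P ((T ^^ i) x))"
          using cell[OF xf f] by auto
        \<comment> \<open>Since \<open>0 < n\<close>, some index exists and yields
          \<open>y \<in> space M\<close>; an empty intersection would be the whole type.\<close>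
        finally show ?thesis using n unfolding X_eq by blast
      qed
      then have "D = X n -` {X n x} \<inter> space M" "x \<in> space M" using x by auto
      then show "D \<in> (\<lambda>v. X n -` {v} \<inter> space M) ` X n ` space M" by blast
    next
      assume "D \<in> (\<lambda>v. X n -` {v} \<inter> space M) ` X n ` space M"
      then obtain x where x: "x \<in> space M" and D: "D = X n -` {X n x} \<inter> space M" by blast
      have "\<exists>E. E \<in> ?Q i \<and> x \<in> E" for i
        using partition_label(1,2)[OF P T[OF x]] x
        by (intro exI[of _ "(T ^^ i) -` partition_label P ((T ^^ i) x) \<inter> space M"])
           (auto simp: preimage_partition_def)
      \<comment> \<open>The choice is made per partition and not per index:
        \<open>common_refinement\<close> takes a set of partitions, in which equal preimage
        partitions are merged.\<close>
      then have "\<forall>R\<in>?Q ` {..<n}. \<exists>E. E \<in> R \<and> x \<in> E" by blast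
      then obtain f where "\<forall>R\<in>?Q ` {..<n}. f R \<in> R \<and> x \<in> f R" by (rule bchoice[THEN exE])
      then have f: "f (?Q i) \<in> ?Q i" "x \<in> f (?Q i)" if "i < n" for i using that by blast+
      have "y \<in> (\<Inter>i<n. f (?Q i)) \<longleftrightarrow> y \<in> space M \<and> X n y = X n x" for y
      proof -
        have "y \<in> (\<Inter>i<n. f (?Q i)) \<longleftrightarrow> (\<forall>i<n. y \<in> space M \<and> partition_label P ((T ^^ i) y) = partition_label P ((T ^^ i) x))"
          using cell[OF f(2) f(1)] by auto
        then show ?thesis using n unfolding X_eq by blast
      qed
      then have "D = \<Inter> (f ` ?Q ` {..<n})" unfolding D by auto
      moreover have "f \<in> (\<Pi> R\<in>?Q ` {..<n}. R)" using f(1) by (intro Pi_I) blast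
      moreover have "x \<in> D" using x D by auto
      ultimately show "D \<in> iterated_join M T P n"
        unfolding iterated_join_def common_refinement by (intro DiffI UN_I[of f]) auto
    qed
  qed
qed

section \<open>Functions of finitely many coordinates\<close>

text \<open>For a set, this is applied to the membership predicate and then describes a cylinder
  event over the first \<open>m\<close> coordinates.\<close>

definition prefix_determined :: "nat \<Rightarrow> ((nat \<Rightarrow> 'a) \<Rightarrow> 'b) \<Rightarrow> bool" where
  "prefix_determined m f \<longleftrightarrow> (\<forall>x y. (\<forall>i<m. x i = y i) \<longrightarrow> f x = f y)"

lemma prefix_determinedD:
  assumes "prefix_determined m f" and "\<And>i. i < m \<Longrightarrow> x i = y i"
  shows "f x = f y"
  using assms by (simp add: prefix_determined_def)

lemma prefix_determined_mono: "prefix_determined m f \<Longrightarrow> m \<le> n \<Longrightarrow> prefix_determined n f"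
  unfolding prefix_determined_def by (meson less_le_trans)

text \<open>Induction over the generated sigma-algebra: approximability holds for conditions on a
  single coordinate and survives complements and countable unions.\<close>

lemma prefix_determined_approximation:
  fixes A :: "(nat \<Rightarrow> 'b :: second_countable_topology) set"
  assumes sets_N: "sets N = sets borel" and "prob_space N" and "A \<in> sets N" and "0 < d"
  shows "\<exists>m C. prefix_determined m (\<lambda>x. x \<in> C) \<and> C \<in> sets N \<and> measure N (sym_diff A C) < d"
proof -
  interpret N: prob_space N by fact
  define G where "G = {{f \<in> \<Pi>\<^sub>E i\<in>UNIV. space borel. f i \<in> A} | i A. i \<in> (UNIV :: nat set) \<and> A \<in> sets (borel :: 'b measure)}"
  have sp: "space N = UNIV" using sets_eq_imp_space_eq[OF sets_N] by simp
  \<comment> \<open>By second countability, the Borel sigma-algebra of the sequence space is the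
    product one, which single-coordinate conditions generate.\<close>
  have "sets N = sigma_sets UNIV G"
    unfolding sets_N sets_PiM_equal_borel[symmetric] sets_PiM_single G_def by (simp add: PiE_def)
  with assms(3) have "A \<in> sigma_sets UNIV G" by simp
  then show ?thesis using \<open>0 < d\<close>
  proof (induction arbitrary: d rule: sigma_sets.induct)
    case (Basic A)
    then obtain i S where A: "A = {f. f i \<in> S}" by (auto simp: G_def)
    have "A \<in> sets N" using Basic \<open>sets N = sigma_sets UNIV G\<close> by auto
    moreover have "prefix_determined (Suc i) (\<lambda>x. x \<in> A)" by (auto simp: prefix_determined_def A)
    ultimately show ?case using Basic(2) by (intro exI[of _ "Suc i"] exI[of _ A]) simp
  next
    case Empty
    then show ?case by (intro exI[of _ 0] exI[of _ "{}"]) (simp add: prefix_determined_def)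
  next
    case (Compl A)
    then obtain m C where C: "prefix_determined m (\<lambda>x. x \<in> C)" "C \<in> sets N" "measure N (sym_diff A C) < d" by blast
    have "sym_diff (UNIV - A) (UNIV - C) = sym_diff A C" by auto
    with C show ?case
      using sets.compl_sets[OF C(2)]
      by (intro exI[of _ m] exI[of _ "UNIV - C"]) (auto simp: prefix_determined_def sp)
  next
    case (Union A)
    have A: "A i \<in> sets N" for i using Union(1) \<open>sets N = sigma_sets UNIV G\<close> by auto
    \<comment> \<open>Continuity from below: truncating the union at a suitable \<open>k\<close>
      costs less than \<open>d / 2\<close>.\<close>
    have "(\<lambda>k. measure N (\<Union>i<k. A i)) \<longlonglongrightarrow> measure N (\<Union>k. \<Union>i<k. A i)"
      using A by (intro N.finite_Lim_measure_incseq incseq_SucI UN_mono) auto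
    also have "(\<Union>k. \<Union>i<k. A i) = (\<Union>i. A i)" by auto
    finally have "\<forall>\<^sub>F k in sequentially. measure N (\<Union>i. A i) - d / 2 < measure N (\<Union>i<k. A i)"
      using Union(3) by (intro order_tendstoD(1)) auto
    then obtain k where k: "measure N (\<Union>i. A i) - d / 2 < measure N (\<Union>i<k. A i)"
      by (auto simp: eventually_sequentially)
    \<comment> \<open>The other \<open>d / 2\<close> is shared among the \<open>k\<close> sets; the
      added 1 covers \<open>k = 0\<close>.\<close>
    have "0 < d / (2 * (real k + 1))" using Union(3) by simp
    then have "\<forall>i. \<exists>m C. prefix_determined m (\<lambda>x. x \<in> C) \<and> C \<in> sets N \<and> measure N (sym_diff (A i) C) < d / (2 * (real k + 1))"
      using Union(2) by blast
    then obtain m C where C: "\<And>i. prefix_determined (m i) (\<lambda>x. x \<in> C i)" "\<And>i. C i \<in> sets N"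
        "\<And>i. measure N (sym_diff (A i) (C i)) < d / (2 * (real k + 1))"
      by metis
    let ?C = "\<Union>i<k. C i"
    \<comment> \<open>The sum of the prefix lengths is a convenient common upper bound for
      them.\<close>
    have "prefix_determined (\<Sum>i<k. m i) (\<lambda>x. x \<in> C i)" if "i < k" for i
      using that by (intro prefix_determined_mono[OF C(1)] member_le_sum) auto
    then have "prefix_determined (\<Sum>i<k. m i) (\<lambda>x. x \<in> ?C)"
      unfolding prefix_determined_def by simp blast
    moreover have "?C \<in> sets N" using C(2) by auto
    moreover have "measure N (sym_diff (\<Union>i. A i) ?C) < d"
    proof -
      have "measure N (sym_diff (\<Union>i. A i) ?C)
          \<le> measure N (((\<Union>i. A i) - (\<Union>i<k. A i)) \<union> (\<Union>i<k. sym_diff (A i) (C i)))"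
        using A C(2) by (intro N.finite_measure_mono) auto
      also have "\<dots> \<le> measure N ((\<Union>i. A i) - (\<Union>i<k. A i)) + measure N (\<Union>i<k. sym_diff (A i) (C i))"
        using A C(2) by (intro measure_Un_le) auto
      also have "measure N ((\<Union>i. A i) - (\<Union>i<k. A i)) = measure N (\<Union>i. A i) - measure N (\<Union>i<k. A i)"
        using A by (intro N.finite_measure_Diff) auto
      also have "\<dots> < d / 2" using k by simp
      also have "measure N (\<Union>i<k. sym_diff (A i) (C i)) \<le> (\<Sum>i<k. measure N (sym_diff (A i) (C i)))"
        using A C(2) by (intro N.finite_measure_subadditive_finite) auto
      also have "\<dots> \<le> real (card {..<k}) * (d / (2 * (real k + 1)))"
        using C(3) by (intro sum_bounded_above less_imp_le) auto
      also have "\<dots> \<le> d / 2" using Union(3) by (simp add: field_simps)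
      finally show ?thesis by simp
    qed
    ultimately show ?case by blast
  qed
qed

section \<open>Entropy of itineraries of the shift\<close>

lemma left_shift_funpow: "(left_shift ^^ n) x i = x (n + i)"
  by (induction n arbitrary: x i) (simp_all add: left_shift_def)

text \<open>The fibre coordinate is overwritten at each step by the symbol just shifted away. At
  time 0 it is still \<open>y\<close>, hence the \<open>Suc\<close>.\<close>

lemma snd_skew_map_funpow_Suc: "snd ((skew_map ^^ Suc n) (x, y)) = x n"
proof -
  have "fst ((skew_map ^^ n) (x, y)) = (left_shift ^^ n) x"
    by (induction n) (simp_all add: skew_map_def split_beta)
  then show ?thesis by (simp add: skew_map_def split_beta left_shift_funpow)
qed

text \<open>Allows \<open>prefix_determined_approximation\<close> to be used for binary sequences;
  all subsets of the two-point space form a finite base.\<close>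

instance bool :: second_countable_topology
proof
  have "(open :: bool set \<Rightarrow> bool) = generate_topology UNIV"
    by (intro ext) (simp add: Topological_Spaces.open_discrete generate_topology.Basis)
  then show "\<exists>B :: bool set set. countable B \<and> open = generate_topology B"
    by (intro exI[of _ UNIV]) (simp add: countable_finite)
qed

locale shift_information_space = information_space M b
  for M :: "symbol_seq measure" and b +
  assumes sets_M: "sets M = sets borel"
    and invariant: "invariant_measure M left_shift"
begin

lemma space_M: "space M = UNIV"
  using sets_eq_imp_space_eq[OF sets_M] by simp

lemma simple_function_coordinate: "simple_function M (\<lambda>x. x i)"
proof -
  have "(\<lambda>x. x i) \<in> measurable (Pi\<^sub>M UNIV (\<lambda>_. borel)) (borel :: bool measure)"
    by (rule measurable_component_singleton) simp
  also have "measurable (Pi\<^sub>M UNIV (\<lambda>_. borel)) (borel :: bool measure) = measurable M borel"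
    by (rule measurable_cong_sets) (simp_all add: sets_M sets_PiM_equal_borel)
  finally have "(\<lambda>x. x i) -` {v} \<inter> space M \<in> events" for v
    by (rule measurable_sets) simp
  then show ?thesis by (simp add: simple_function_def)
qed

lemma simple_function_prefix: "simple_function M (\<lambda>x. map x [0..<m])"
  using entropy_map_upt_le(1)[OF simple_function_coordinate] .

lemma simple_function_prefix_determined:
  assumes "prefix_determined m f"
  shows "simple_function M f"
  by (rule simple_function_of_determined(1)[OF simple_function_prefix[of m]])
     (use assms in \<open>auto simp: prefix_determined_def\<close>)

text \<open>Each of the finitely many fibres of \<open>p\<close> is approximated by a cylinder
  event, and a value is then read off from the cylinders containing the point.\<close>

lemma simple_function_approximation:
  assumes p: "simple_function M p" and "0 < d"
  shows "\<exists>m q. prefix_determined m q \<and> prob {x \<in> space M. p x \<noteq> q x} < d"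
proof -
  let ?V = "p ` space M"
  have V: "finite ?V" by (rule simple_functionD(1)[OF p])
  define c where "c = d / (real (card ?V) + 1)"
  have "0 < c" using \<open>0 < d\<close> by (simp add: c_def)
  then have "\<forall>v. \<exists>m C. prefix_determined m (\<lambda>x. x \<in> C) \<and> C \<in> events \<and>
      prob (sym_diff (p -` {v} \<inter> space M) C) < c"
    using prefix_determined_approximation[OF sets_M prob_space_axioms simple_functionD(2)[OF p]] by blast
  then obtain m C where C: "\<And>v. prefix_determined (m v) (\<lambda>x. x \<in> C v)" "\<And>v. C v \<in> events"
      "\<And>v. prob (sym_diff (p -` {v} \<inter> space M) (C v)) < c"
    by metis
  \<comment> \<open>Off the symmetric differences, \<open>p x\<close> is the only candidate value.
    Elsewhere the choice may be wrong, but it still depends only on which cylinders contain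
    \<open>x\<close>.\<close>
  define q where "q x = (SOME v. v \<in> ?V \<and> x \<in> C v)" for x
  have mono: "prefix_determined (\<Sum>v\<in>?V. m v) (\<lambda>x. x \<in> C v)" if "v \<in> ?V" for v
    using that V by (intro prefix_determined_mono[OF C(1)] member_le_sum) auto
  have "prefix_determined (\<Sum>v\<in>?V. m v) q"
    unfolding prefix_determined_def
  proof (intro allI impI)
    fix x y :: symbol_seq
    assume "\<forall>i<\<Sum>v\<in>?V. m v. x i = y i"
    then have "x \<in> C v \<longleftrightarrow> y \<in> C v" if "v \<in> ?V" for v
      using prefix_determinedD[OF mono[OF that], of x y] by simp
    then have "(\<lambda>v. v \<in> ?V \<and> x \<in> C v) = (\<lambda>v. v \<in> ?V \<and> y \<in> C v)" by (intro ext) blast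
    then show "q x = q y" unfolding q_def by simp
  qed
  moreover have "prob {x \<in> space M. p x \<noteq> q x} < d"
  proof -
    have q: "p x = q x" if "x \<in> space M" "\<And>v. v \<in> ?V \<Longrightarrow> x \<notin> sym_diff (p -` {v} \<inter> space M) (C v)" for x
    proof -
      have "v \<in> ?V \<and> x \<in> C v \<longleftrightarrow> v = p x" for v
        using that(1) that(2)[of v] that(2)[of "p x"] by auto
      then show ?thesis unfolding q_def by simp
    qed
    let ?D = "\<lambda>v. sym_diff (p -` {v} \<inter> space M) (C v)"
    have D: "?D v \<in> events" for v using C(2)[of v] simple_functionD(2)[OF p, of "{v}"] by auto
    have "prob {x \<in> space M. p x \<noteq> q x} \<le> prob (\<Union>v\<in>?V. ?D v)"
    proof (rule finite_measure_mono)
      show "{x \<in> space M. p x \<noteq> q x} \<subseteq> (\<Union>v\<in>?V. ?D v)"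
      proof (rule subsetI, rule ccontr)
        fix x assume x: "x \<in> {x \<in> space M. p x \<noteq> q x}" "x \<notin> (\<Union>v\<in>?V. ?D v)"
        have "p x = q x"
        proof (rule q)
          show "x \<in> space M" by (simp add: space_M)
          show "x \<notin> ?D v" if "v \<in> ?V" for v using x(2) that by (simp only: UN_iff) blast
        qed
        with x(1) show False by simp
      qed
      show "(\<Union>v\<in>?V. ?D v) \<in> events" using V D by (intro sets.finite_UN)
    qed
    also have "\<dots> \<le> (\<Sum>v\<in>?V. prob (?D v))"
      using D V by (intro finite_measure_subadditive_finite image_subsetI)
    also have "\<dots> \<le> real (card ?V) * c" using C(3) by (intro sum_bounded_above less_imp_le)
    also have "\<dots> < d" using \<open>0 < d\<close> by (simp add: c_def field_simps)
    finally show ?thesis .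
  qed
  ultimately show ?thesis by blast
qed

text \<open>The code is the window of \<open>m\<close> symbols at time \<open>n\<close> together
  with \<open>n\<close> pairs of corrections. The window sits at the end because \<open>g\<close>
  predicts a symbol from its future; invariance gives it the entropy of the initial prefix.\<close>

lemma itinerary_entropy_le:
  fixes g :: "symbol_seq \<Rightarrow> bool"
  assumes p: "simple_function M p" and g: "prefix_determined m g" and q: "prefix_determined m q"
  defines "e \<equiv> \<lambda>x. if x 0 = g (left_shift x) then None else Some (x 0)"
    and "e' \<equiv> \<lambda>x. if p x = q x then None else Some (p x)"
  shows "\<H>(\<lambda>x. map (\<lambda>i. p ((left_shift ^^ i) x)) [0..<n]) \<le>
    \<H>(\<lambda>x. map x [0..<m]) + real n * (\<H>(e) + \<H>(e'))"
proof -
  note inv = invariant_measure_funpow[OF invariant]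
  let ?T = left_shift
  let ?W = "\<lambda>x :: symbol_seq. map x [0..<m]"
  let ?E = "\<lambda>i x. (e ((?T ^^ i) x), e' ((?T ^^ i) x))"
  have gT: "simple_function M (\<lambda>x. g (?T x))"
    using entropy_comp_invariant(1)[OF simple_function_prefix_determined[OF g] inv, of 1] by simp
  have e: "simple_function M e"
    unfolding e_def by (rule entropy_mismatch_le(1)[OF simple_function_coordinate gT])
  have e': "simple_function M e'"
    unfolding e'_def by (rule entropy_mismatch_le(1)[OF p simple_function_prefix_determined[OF q]])
  note E = entropy_comp_invariant[OF simple_function_Pair[OF e e'] inv]
  note EL = entropy_map_upt_le[of ?E, OF E(1), of n]
  note W = entropy_comp_invariant[OF simple_function_prefix[of m] inv, of n]
  have "\<H>(\<lambda>x. map (\<lambda>i. p ((?T ^^ i) x)) [0..<n]) \<le> \<H>(\<lambda>x. (?W ((?T ^^ n) x), map (\<lambda>i. ?E i x) [0..<n]))"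
  proof (rule simple_function_of_determined(2)[OF simple_function_Pair[OF W(1) EL(1)]])
    fix x y
    assume eq: "(?W ((?T ^^ n) x), map (\<lambda>i. ?E i x) [0..<n]) = (?W ((?T ^^ n) y), map (\<lambda>i. ?E i y) [0..<n])"
    have tail: "x (n + j) = y (n + j)" if "j < m" for j
    proof -
      have "?W ((?T ^^ n) x) ! j = ?W ((?T ^^ n) y) ! j"
        by (rule arg_cong[OF conjunct1[OF eq[unfolded prod.inject]]])
      with that show ?thesis by (simp add: left_shift_funpow)
    qed
    have letter: "map (\<lambda>i. ?E i x) [0..<n] ! i = map (\<lambda>i. ?E i y) [0..<n] ! i" for i
      by (rule arg_cong[OF conjunct2[OF eq[unfolded prod.inject]]])
    have ee: "e ((?T ^^ i) x) = e ((?T ^^ i) y)" if "i < n" for i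
      using arg_cong[OF letter[of i], of fst] that by simp
    have ee': "e' ((?T ^^ i) x) = e' ((?T ^^ i) y)" if "i < n" for i
      using arg_cong[OF letter[of i], of snd] that by simp
    \<comment> \<open>Decoding runs backwards from time \<open>n\<close>: the future window and \<open>e\<close> give the present symbol.\<close>
    have agree: "k \<le> n \<Longrightarrow> n - k \<le> i \<Longrightarrow> i < n + m \<Longrightarrow> x i = y i" for k i
    proof (induction k arbitrary: i)
      case 0
      then show ?case using tail[of "i - n"] by simp
    next
      case (Suc k)
      show ?case
      proof (cases "n - k \<le> i")
        case True
        then show ?thesis using Suc by simp
      next
        case False
        then have i: "i = n - Suc k" "i < n" using Suc.prems by auto
        have "(?T ((?T ^^ i) x)) j = (?T ((?T ^^ i) y)) j" if "j < m" for j
          using Suc.IH[of "i + Suc j"] Suc.prems that i by (simp add: left_shift_def left_shift_funpow)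
        then have "g (?T ((?T ^^ i) x)) = g (?T ((?T ^^ i) y))"
          by (rule prefix_determinedD[OF g])
        \<comment> \<open>If the common correction is \<open>None\<close>, both symbols equal the
          common prediction; otherwise it carries the symbol itself.\<close>
        then have "(?T ^^ i) x 0 = (?T ^^ i) y 0"
          using ee[OF i(2)] unfolding e_def by (auto split: if_splits)
        then show ?thesis by (simp add: left_shift_funpow)
      qed
    qed
    have "p ((?T ^^ i) x) = p ((?T ^^ i) y)" if i: "i < n" for i
    proof -
      have "(?T ^^ i) x j = (?T ^^ i) y j" if "j < m" for j
        using agree[of n "i + j"] that i by (simp add: left_shift_funpow)
      then have "q ((?T ^^ i) x) = q ((?T ^^ i) y)"
        by (rule prefix_determinedD[OF q])
      then show ?thesis
        using ee'[OF i] unfolding e'_def by (auto split: if_splits)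
    qed
    then show "map (\<lambda>i. p ((?T ^^ i) x)) [0..<n] = map (\<lambda>i. p ((?T ^^ i) y)) [0..<n]" by simp
  qed
  also have "\<dots> \<le> \<H>(\<lambda>x. ?W ((?T ^^ n) x)) + \<H>(\<lambda>x. map (\<lambda>i. ?E i x) [0..<n])"
    by (rule entropy_Pair_le[OF W(1) EL(1)])
  also have "\<dots> \<le> \<H>(?W) + (\<Sum>i<n. \<H>(\<lambda>x. (e x, e' x)))"
    using W(2) EL(2) E(2) by simp
  also have "\<dots> \<le> \<H>(?W) + real n * (\<H>(e) + \<H>(e'))"
    using entropy_Pair_le[OF e e'] by (simp add: mult_left_mono)
  finally show ?thesis .
qed

text \<open>Approximating \<open>A\<close> and \<open>p\<close> by prefix-determined functions
  brings each correction down to entropy at most \<open>\<epsilon> / 2\<close>. The constant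
  \<open>K\<close> is the entropy of a prefix whose length depends on \<open>\<epsilon>\<close> but
  not on \<open>n\<close>.\<close>

lemma itinerary_entropy_sublinear:
  assumes p: "simple_function M p" and A: "A \<in> events"
    and ae: "AE x in M. x 0 = (left_shift x \<in> A)" and "0 < \<epsilon>"
  shows "\<exists>K. \<forall>n. \<H>(\<lambda>x. map (\<lambda>i. p ((left_shift ^^ i) x)) [0..<n]) \<le> K + real n * \<epsilon>"
proof -
  note inv = invariant_measure_funpow[OF invariant, of 1, simplified]
  have A': "simple_function M (\<lambda>x. x \<in> A)"
  proof -
    have "(\<lambda>x. x \<in> A) -` {v} \<inter> space M = (if v then A else space M - A)" for v
      using space_M by auto
    then show ?thesis unfolding simple_function_def using A by simp
  qed
  obtain d where d: "0 < d" "\<And>g. simple_function M g \<Longrightarrow> prob {x \<in> space M. x 0 \<noteq> g x} < d \<Longrightarrow>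
      \<H>(\<lambda>x. if x 0 = g x then None else Some (x 0)) \<le> \<epsilon> / 2"
    using entropy_mismatch_small[OF simple_function_coordinate[of 0], of "\<epsilon> / 2"] \<open>0 < \<epsilon>\<close> by auto
  obtain d' where d': "0 < d'" "\<And>g. simple_function M g \<Longrightarrow> prob {x \<in> space M. p x \<noteq> g x} < d' \<Longrightarrow>
      \<H>(\<lambda>x. if p x = g x then None else Some (p x)) \<le> \<epsilon> / 2"
    using entropy_mismatch_small[OF p, of "\<epsilon> / 2"] \<open>0 < \<epsilon>\<close> by auto
  obtain m1 g where g: "prefix_determined m1 g" "prob {x \<in> space M. (x \<in> A) \<noteq> g x} < d"
    using simple_function_approximation[OF A' d(1)] by blast
  obtain m2 q where q: "prefix_determined m2 q" "prob {x \<in> space M. p x \<noteq> q x} < d'"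
    using simple_function_approximation[OF p d'(1)] by blast
  have gm: "prefix_determined (max m1 m2) g" and qm: "prefix_determined (max m1 m2) q"
    using prefix_determined_mono[OF g(1)] prefix_determined_mono[OF q(1)] by auto
  note gs = simple_function_prefix_determined[OF g(1)]
  have gT: "simple_function M (\<lambda>x. g (left_shift x))"
    using entropy_comp_invariant(1)[OF gs inv] .
  let ?D = "{x \<in> space M. (x \<in> A) \<noteq> g x}"
  have D: "?D \<in> events"
    using simple_functionD(2)[OF simple_function_Pair[OF A' gs], of "{(True, False), (False, True)}"]
    by (rule back_subst[of "\<lambda>S. S \<in> events"]) auto
  have D': "{x \<in> space M. x 0 \<noteq> g (left_shift x)} \<in> events"
    using simple_functionD(2)[OF simple_function_Pair[OF simple_function_coordinate[of 0] gT], of "{(True, False), (False, True)}"]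
    by (rule back_subst[of "\<lambda>S. S \<in> events"]) auto
  \<comment> \<open>Almost surely \<open>x 0\<close> may be replaced by
    \<open>left_shift x \<in> A\<close>, which makes the event a shift preimage of
    \<open>?D\<close>; invariance then carries over the bound for \<open>g\<close>.\<close>
  have "prob {x \<in> space M. x 0 \<noteq> g (left_shift x)} = prob (left_shift -` ?D \<inter> space M)"
  proof (rule finite_measure_eq_AE)
    show "AE x in M. x \<in> {x \<in> space M. x 0 \<noteq> g (left_shift x)} \<longleftrightarrow> x \<in> left_shift -` ?D \<inter> space M"
      using ae by (rule eventually_mono) (auto simp: space_M)
  qed (use D' measurable_sets[OF inv(1) D] in auto)
  also have "\<dots> = prob ?D" using measure_distr[OF inv(1) D] inv(2) by simp
  finally have "\<H>(\<lambda>x. if x 0 = g (left_shift x) then None else Some (x 0)) \<le> \<epsilon> / 2"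
    using d(2)[OF gT] g(2) by simp
  moreover have "\<H>(\<lambda>x. if p x = q x then None else Some (p x)) \<le> \<epsilon> / 2"
    using d'(2)[OF simple_function_prefix_determined[OF q(1)] q(2)] .
  ultimately have sum_le: "\<H>(\<lambda>x. if x 0 = g (left_shift x) then None else Some (x 0)) +
      \<H>(\<lambda>x. if p x = q x then None else Some (p x)) \<le> \<epsilon>" by simp
  have "\<H>(\<lambda>x. map (\<lambda>i. p ((left_shift ^^ i) x)) [0..<n]) \<le>
      \<H>(\<lambda>x. map x [0..<max m1 m2]) + real n * \<epsilon>" for n
    using itinerary_entropy_le[OF p gm qm, of n] mult_left_mono[OF sum_le, of "real n"] by simp
  then show ?thesis by blast
qed

text \<open>The normalised entropies are nonnegative and, up to the factor \<open>ln b\<close>, at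
  most \<open>K / n + \<epsilon>\<close>. Actual convergence to 0 is proved, since the value of
  \<open>lim\<close> is only meaningful then.\<close>

lemma entropy_wrt_partition_eq_0:
  assumes P: "finite_measurable_partition M P" and A: "A \<in> events"
    and ae: "AE x in M. x 0 = (left_shift x \<in> A)"
  shows "entropy_wrt_partition M left_shift P = 0"
proof -
  let ?p = "partition_label P"
  let ?X = "\<lambda>n x. map (\<lambda>i. ?p ((left_shift ^^ i) x)) [0..<n]"
  have p: "simple_function M ?p" by (rule simple_function_partition_label[OF P])
  have X: "simple_function M (?X n)" for n
    by (intro entropy_map_upt_le(1) entropy_comp_invariant(1)[OF p] invariant_measure_funpow[OF invariant])
  have lnb: "0 < ln b" using b_gt_1 by simp
  have eq: "partition_entropy M (iterated_join M left_shift P n) = \<H>(?X n) * ln b" if "0 < n" for n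
    using iterated_join_eq_fibres[of M P left_shift n] that P partition_entropy_fibres[OF X]
    by (simp add: finite_measurable_partition_def space_M)
  have "(\<lambda>n. partition_entropy M (iterated_join M left_shift P n) / real n) \<longlonglongrightarrow> 0"
  proof (rule LIMSEQ_I)
    fix r :: real assume "0 < r"
    \<comment> \<open>In natural logarithms the linear term becomes \<open>r / 2\<close> per step;
      \<open>N\<close> below is chosen so that the constant term takes less than the other
      half.\<close>
    define \<epsilon> where "\<epsilon> = r / (2 * ln b)"
    have "0 < \<epsilon>" using \<open>0 < r\<close> lnb by (simp add: \<epsilon>_def)
    then obtain K where K: "\<And>n. \<H>(?X n) \<le> K + real n * \<epsilon>"
      using itinerary_entropy_sublinear[OF p A ae] by blast
    obtain N :: nat where N: "2 * K * ln b / r < real N" using reals_Archimedean2 by blast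
    show "\<exists>n0. \<forall>n\<ge>n0. norm (partition_entropy M (iterated_join M left_shift P n) / real n - 0) < r"
    proof (intro exI allI impI)
      \<comment> \<open>Starting at \<open>Suc N\<close> keeps \<open>n\<close> positive, as the
        division and \<open>iterated_join_eq_fibres\<close> require.\<close>
      fix n assume n: "Suc N \<le> n"
      have "2 * K * ln b / r < real n" using N n by linarith
      then have "2 * K * ln b < real n * r" using \<open>0 < r\<close> by (simp add: divide_less_eq)
      moreover have "\<H>(?X n) * ln b \<le> (K + real n * \<epsilon>) * ln b"
        using K lnb by (intro mult_right_mono) auto
      moreover have "(K + real n * \<epsilon>) * ln b = K * ln b + real n * r / 2"
        using lnb by (simp add: \<epsilon>_def field_simps)
      ultimately have "\<H>(?X n) * ln b < real n * r" by linarith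
      moreover have "0 \<le> \<H>(?X n) * ln b" using entropy_nonneg[OF X] lnb by simp
      ultimately show "norm (partition_entropy M (iterated_join M left_shift P n) / real n - 0) < r"
        using eq[of n] n by (simp add: divide_less_eq mult.commute)
    qed
  qed
  then show ?thesis unfolding entropy_wrt_partition_def by (rule limI)
qed

text \<open>As \<open>\<phi>\<close> is measurable only for the completion, it is replaced by a
  Borel set \<open>A\<close> agreeing with it off a null set. By invariance the agreement holds
  along the whole orbit of almost every point, so attraction makes the failure event
  \<open>?E\<close> eventually avoided, hence null.\<close>

lemma first_symbol_eq_graph:
  assumes \<phi>: "\<phi> \<in> measurable (completion M) (count_space UNIV)"
    and Z: "Z \<in> sets (completion M)" "measure (completion M) Z = 1"
    and att: "graph_attracts_over \<phi> Z"
  shows "\<exists>A\<in>events. AE x in M. x 0 = (left_shift x \<in> A)"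
proof -
  note inv = invariant_measure_funpow[OF invariant]
  have "{x. \<phi> x} \<in> sets (completion M)"
    using measurable_sets[OF \<phi>, of "{True}"] by (simp add: vimage_def space_M)
  then obtain A N N' where A: "{x. \<phi> x} = A \<union> N" "N \<subseteq> N'" "N' \<in> null_sets M" "A \<in> events"
    by (rule sets_completionE)
  have 1: "AE x in M. \<phi> ((left_shift ^^ n) x) = ((left_shift ^^ n) x \<in> A)" for n
  proof -
    have "AE x in distr M M (left_shift ^^ n). x \<notin> N'" unfolding inv(2) by (rule AE_not_in[OF A(3)])
    then have "AE x in M. (left_shift ^^ n) x \<notin> N'" by (rule AE_distrD[OF inv(1)])
    then show ?thesis by (rule eventually_mono) (use A(1,2) in blast)
  qed
  have 2: "AE x in M. x \<in> Z"
  proof -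
    interpret completion: prob_space "completion M"
      by (rule prob_spaceI) (simp add: emeasure_space_1)
    have "AE x in completion M. x \<in> Z" using Z by (simp add: completion.AE_in_set_eq_1)
    then show ?thesis by (simp add: AE_completion_iff)
  qed
  let ?E = "{x \<in> space M. x 0 \<noteq> (left_shift x \<in> A)}"
  have E: "?E \<in> events"
  proof -
    have "(\<lambda>x. x 0) -` {True} \<inter> space M \<in> events"
      by (rule simple_functionD(2)[OF simple_function_coordinate])
    moreover have "left_shift -` A \<inter> space M \<in> events" using measurable_sets[OF inv(1)[of 1] A(4)] by simp
    moreover have "?E = sym_diff ((\<lambda>x. x 0) -` {True} \<inter> space M) (left_shift -` A \<inter> space M)" by auto
    ultimately show ?thesis by auto
  qed
  have "AE x in M. \<forall>n. \<phi> ((left_shift ^^ n) x) = ((left_shift ^^ n) x \<in> A)"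
    using 1 by (simp add: AE_all_countable)
  with 2 have "AE x in M. \<exists>N. \<forall>n\<ge>N. (left_shift ^^ n) x \<notin> ?E"
  proof eventually_elim
    case (elim x)
    then have "(x, False) \<in> basin_of_graph \<phi>" using att by (auto simp: graph_attracts_over_def)
    then obtain N where N: "\<And>n. n \<ge> N \<Longrightarrow> snd ((skew_map ^^ n) (x, False)) = \<phi> ((left_shift ^^ n) x)"
      by (auto simp: basin_of_graph_def)
    have "(left_shift ^^ n) x \<notin> ?E" if "n \<ge> N" for n
      \<comment> \<open>Membership of the \<open>n\<close>-th iterate in \<open>?E\<close> compares
        \<open>x n\<close> with the iterate at time \<open>Suc n\<close>, and \<open>x n\<close> is
        the fibre coordinate at that same time.\<close>
      using N[of "Suc n"] that elim(2)[rule_format, of "Suc n"] unfolding snd_skew_map_funpow_Suc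
      by (simp add: left_shift_funpow)
    then show ?case by blast
  qed
  then have "prob ?E = 0" by (rule eventually_avoided_imp_null[OF invariant E])
  then have "AE x in M. x \<notin> ?E" using E by (subst (asm) prob_eq_0) auto
  then have "AE x in M. x 0 = (left_shift x \<in> A)" by (rule eventually_mono) (simp add: space_M)
  with A(4) show ?thesis by blast
qed

end

theorem theorem3p3:
  fixes \<mu> :: "(nat \<Rightarrow> bool) measure"
  assumes "prob_space \<mu>"
    and "sets \<mu> = sets borel"
    and "ergodic_measure \<mu> left_shift"
    and "\<exists>\<phi> Z. \<phi> \<in> measurable (completion \<mu>) (count_space UNIV) \<and>
           Z \<in> sets (completion \<mu>) \<and> measure (completion \<mu>) Z = 1 \<and>
           graph_attracts_over \<phi> Z"
  shows "measure_entropy \<mu> left_shift = 0"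
proof -
  interpret prob_space \<mu> by fact
  \<comment> \<open>Any base above 1 is admissible; \<open>partition_entropy\<close> itself uses
    natural logarithms.\<close>
  interpret shift_information_space \<mu> "exp 1"
    using assms(2,3) by unfold_locales (auto simp: ergodic_measure_def)
  obtain A where A: "A \<in> events" "AE x in \<mu>. x 0 = (left_shift x \<in> A)"
    using assms(4) first_symbol_eq_graph by blast
  \<comment> \<open>The trivial partition makes the index set nonempty; over an empty set the
    supremum in \<open>ereal\<close> would be minus infinity instead of 0.\<close>
  have "finite_measurable_partition \<mu> {space \<mu>}"
    using sets.top[of \<mu>] by (auto simp: finite_measurable_partition_def partition_on_def space_M)
  then have "{P. finite_measurable_partition \<mu> P} \<noteq> {}" by blast
  moreover have "entropy_wrt_partition \<mu> left_shift P = 0" if "P \<in> {P. finite_measurable_partition \<mu> P}" for P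
    using entropy_wrt_partition_eq_0[OF _ A] that by simp
  ultimately show ?thesis
    unfolding measure_entropy_def by (intro SUP_eq_const) auto
qed

end
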